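(* Let $\mathbf{A}$ be a quasicomplemented distributive nearlattice. Then the following are equivalent: (1) $\mathbf{A}$ is Stone; (2) every prime ideal of $A$ is contained in exactly one prime $\alpha$-ideal.
   Context: A distributive nearlattice is a join-semilattice $\langle A,\vee,1\rangle$ with greatest element $1$ in which every principal filter $[a)=\{x\in A\colon a\le x\}$ is a bounded distributive lattice. A filter of $A$ is a subset containing $1$, upward closed, and closed under those binary meets that exist; for filters $F,G$, $F\veebar G$ is the smallest filter containing $F\cup G$. An ideal is a downward closed, $\vee$-closed subset; a prime ideal is a non-empty proper ideal $P$ with $a\wedge b\in P\Rightarrow a\in P$ or $b\in P$ whenever $a\wedge b$ exists. For $a\in A$, $a^{\top}=\{x\in A\colon x\vee a=1\}$ and $a^{\top\top}=\{y\in A\colon y\vee x=1\text{ for all }x\in a^{\top}\}$. An ideal $I$ is an $\alpha$-ideal if for each $a\in A$, $I\cap a^{\top\top}\ne\emptyset$ implies $a\in I$. $\mathbf{A}$ is quasicomplemented if for each $a\in A$ there exists $b\in A$ with $a^{\top\top}=b^{\top}$; $\mathbf{A}$ is Stone if $a^{\top}\veebar a^{\top\top}=A$ for every $a\in A$. *)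

theory Defs
  imports Main
begin

text \<open>Binary infima and suprema relative to a subset \<open>S\<close> of an order;
  with \<open>S = UNIV\<close>, \<open>inf_on\<close> is the partial meet of the whole structure.\<close>

definition (in order) inf_on :: "'a set \<Rightarrow> 'a \<Rightarrow> 'a \<Rightarrow> 'a \<Rightarrow> bool" where
  "inf_on S x y m \<longleftrightarrow> m \<in> S \<and> m \<le> x \<and> m \<le> y \<and> (\<forall>z\<in>S. z \<le> x \<and> z \<le> y \<longrightarrow> z \<le> m)"

definition (in order) sup_on :: "'a set \<Rightarrow> 'a \<Rightarrow> 'a \<Rightarrow> 'a \<Rightarrow> bool" where
  "sup_on S x y j \<longleftrightarrow> j \<in> S \<and> x \<le> j \<and> y \<le> j \<and> (\<forall>z\<in>S. x \<le> z \<and> y \<le> z \<longrightarrow> j \<le> z)"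

text \<open>The last conjunct is \<open>x \<and> (y \<or> z) = (x \<and> y) \<or> (x \<and> z)\<close>, with the operations computed in \<open>S\<close>.\<close>

definition (in order) bounded_distributive_lattice_on :: "'a set \<Rightarrow> bool" where
  "bounded_distributive_lattice_on S \<longleftrightarrow>
     (\<exists>b\<in>S. \<forall>x\<in>S. b \<le> x) \<and> (\<exists>t\<in>S. \<forall>x\<in>S. x \<le> t) \<and>
     (\<forall>x\<in>S. \<forall>y\<in>S. (\<exists>m. inf_on S x y m) \<and> (\<exists>j. sup_on S x y j)) \<and>
     (\<forall>x\<in>S. \<forall>y\<in>S. \<forall>z\<in>S. \<forall>j m m1 m2.
        sup_on S y z j \<and> inf_on S x j m \<and> inf_on S x y m1 \<and> inf_on S x z m2
          \<longrightarrow> sup_on S m1 m2 m)"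

class distributive_nearlattice = semilattice_sup + order_top +
  assumes principal_filter_distributive: "bounded_distributive_lattice_on {a..}"

definition nl_filter :: "'a::distributive_nearlattice set \<Rightarrow> bool" where
  "nl_filter F \<longleftrightarrow> top \<in> F \<and> (\<forall>x\<in>F. \<forall>y. x \<le> y \<longrightarrow> y \<in> F) \<and>
     (\<forall>x\<in>F. \<forall>y\<in>F. \<forall>m. inf_on UNIV x y m \<longrightarrow> m \<in> F)"

definition filter_join :: "'a::distributive_nearlattice set \<Rightarrow> 'a set \<Rightarrow> 'a set" where
  "filter_join F G = \<Inter>{H. nl_filter H \<and> F \<union> G \<subseteq> H}"

lemma filter_join_smallest:
  shows "nl_filter (filter_join F G)"
    and "F \<union> G \<subseteq> filter_join F G"
    and "nl_filter H \<Longrightarrow> F \<union> G \<subseteq> H \<Longrightarrow> filter_join F G \<subseteq> H"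
proof -
  have mem: "x \<in> filter_join F G \<longleftrightarrow> (\<forall>H. nl_filter H \<longrightarrow> F \<union> G \<subseteq> H \<longrightarrow> x \<in> H)" for x
    by (auto simp: filter_join_def)
  have up: "y \<in> filter_join F G" if "x \<in> filter_join F G" "x \<le> y" for x y
    unfolding mem
  proof (intro allI impI)
    fix H assume H: "nl_filter H" "F \<union> G \<subseteq> H"
    then have "x \<in> H" using that(1) mem by blast
    with H(1) that(2) show "y \<in> H" unfolding nl_filter_def by blast
  qed
  have meet: "m \<in> filter_join F G"
    if "x \<in> filter_join F G" "y \<in> filter_join F G" "inf_on UNIV x y m" for x y m
    unfolding mem
  proof (intro allI impI)
    fix H assume H: "nl_filter H" "F \<union> G \<subseteq> H"
    then have "x \<in> H" "y \<in> H" using that(1,2) mem by blast+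
    with H(1) that(3) show "m \<in> H" unfolding nl_filter_def by blast
  qed
  have "top \<in> filter_join F G" by (simp add: mem nl_filter_def)
  with up meet show "nl_filter (filter_join F G)" unfolding nl_filter_def by blast
qed (auto simp: filter_join_def)

definition nl_ideal :: "'a::distributive_nearlattice set \<Rightarrow> bool" where
  "nl_ideal I \<longleftrightarrow> (\<forall>x\<in>I. \<forall>y. y \<le> x \<longrightarrow> y \<in> I) \<and> (\<forall>x\<in>I. \<forall>y\<in>I. sup x y \<in> I)"

definition nl_prime_ideal :: "'a::distributive_nearlattice set \<Rightarrow> bool" where
  "nl_prime_ideal P \<longleftrightarrow> nl_ideal P \<and> P \<noteq> {} \<and> P \<noteq> UNIV \<and>
     (\<forall>a b m. inf_on UNIV a b m \<and> m \<in> P \<longrightarrow> a \<in> P \<or> b \<in> P)"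

definition annihilator :: "'a::distributive_nearlattice \<Rightarrow> 'a set" where
  "annihilator a = {x. sup x a = top}"

definition double_annihilator :: "'a::distributive_nearlattice \<Rightarrow> 'a set" where
  "double_annihilator a = {y. \<forall>x\<in>annihilator a. sup y x = top}"

definition alpha_ideal :: "'a::distributive_nearlattice set \<Rightarrow> bool" where
  "alpha_ideal I \<longleftrightarrow> nl_ideal I \<and> (\<forall>a. I \<inter> double_annihilator a \<noteq> {} \<longrightarrow> a \<in> I)"

definition quasicomplemented :: "'a::distributive_nearlattice itself \<Rightarrow> bool" where
  "quasicomplemented _ \<longleftrightarrow> (\<forall>a::'a. \<exists>b. double_annihilator a = annihilator b)"

definition stone :: "'a::distributive_nearlattice itself \<Rightarrow> bool" where
  "stone _ \<longleftrightarrow> (\<forall>a::'a. filter_join (annihilator a) (double_annihilator a) = UNIV)"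

end

theory Submission
  imports Defs
begin

text \<open>
  An ideal that is maximal among those disjoint from a filter \<open>F\<close> is prime, and it is an
  \<open>\<alpha>\<close>-ideal if \<open>F = {1}\<close>.

  If \<open>A\<close> is Stone and \<open>Q\<close>, \<open>R\<close> are prime \<open>\<alpha>\<close>-ideals above a prime ideal \<open>P\<close> with \<open>a \<in> Q - R\<close>,
  then the filter \<open>A - P\<close> cannot contain both \<open>a\<^sup>\<top>\<close> and \<open>a\<^sup>\<top>\<^sup>\<top>\<close>. A common element of \<open>P\<close> and \<open>a\<^sup>\<top>\<close>
  forces \<open>1 \<in> Q\<close>, one of \<open>P\<close> and \<open>a\<^sup>\<top>\<^sup>\<top>\<close> forces \<open>a \<in> R\<close>.

  If \<open>A\<close> is not Stone, separate a point from \<open>a\<^sup>\<top> \<squnion> a\<^sup>\<top>\<^sup>\<top>\<close> by a prime ideal \<open>P\<close>, where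
  \<open>a\<^sup>\<top>\<^sup>\<top> = b\<^sup>\<top>\<close>. Then \<open>P\<close> together with \<open>a\<close>, and \<open>P\<close> together with \<open>b\<close>, both generate proper ideals.
  They lie in maximal ideals, which are distinct since \<open>a \<or> b = 1\<close>.
\<close>

section \<open>Partial meets and distributivity\<close>

lemma inf_on_UNIV_exists:
  fixes p x y :: "'a::distributive_nearlattice"
  assumes "p \<le> x" "p \<le> y"
  shows "\<exists>m\<ge>p. inf_on UNIV x y m"
proof -
  have "x \<in> {p..}" "y \<in> {p..}" using assms by auto
  then obtain m where m: "inf_on {p..} x y m"
    using principal_filter_distributive[of p] unfolding bounded_distributive_lattice_on_def by blast
  have "z \<le> m" if "z \<le> x" "z \<le> y" for z
  proof -
    \<comment> \<open>A lower bound \<open>z\<close> may lie outside \<open>{p..}\<close>;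
      \<open>sup z p\<close> lies inside and is still below \<open>x\<close> and
      \<open>y\<close>.\<close>
    have "sup z p \<in> {p..}" "sup z p \<le> x" "sup z p \<le> y" using that assms by auto
    then have "sup z p \<le> m" using m unfolding inf_on_def by blast
    then show ?thesis by simp
  qed
  then show ?thesis using m unfolding inf_on_def by auto
qed

lemma inf_on_atLeast:
  fixes p x y :: "'a::distributive_nearlattice"
  assumes "inf_on UNIV x y m" "p \<le> x" "p \<le> y"
  shows "inf_on {p..} x y m"
  using assms unfolding inf_on_def by auto

lemma inf_on_sup_distrib:
  fixes a x y z :: "'a::distributive_nearlattice"
  assumes ge: "a \<le> x" "a \<le> y" "a \<le> z"
    and inf: "inf_on UNIV x (sup y z) m" "inf_on UNIV x y m1" "inf_on UNIV x z m2"
  shows "m = sup m1 m2"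
proof -
  have "inf_on {a..} x (sup y z) m" "inf_on {a..} x y m1" "inf_on {a..} x z m2"
    using ge inf by (auto intro!: inf_on_atLeast le_supI1)
  moreover have "sup_on {a..} y z (sup y z)"
    using ge by (auto simp: sup_on_def le_supI1)
  moreover have "x \<in> {a..}" "y \<in> {a..}" "z \<in> {a..}" using ge by auto
  moreover have "\<forall>x\<in>{a..}. \<forall>y\<in>{a..}. \<forall>z\<in>{a..}. \<forall>j m m1 m2.
      sup_on {a..} y z j \<and> inf_on {a..} x j m \<and> inf_on {a..} x y m1 \<and> inf_on {a..} x z m2
        \<longrightarrow> sup_on {a..} m1 m2 m"
    using principal_filter_distributive[of a] unfolding bounded_distributive_lattice_on_def
    by (elim conjE)
  ultimately have "sup_on {a..} m1 m2 m" by blast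
  moreover from this have "sup m1 m2 \<in> {a..}"
    using ge inf unfolding inf_on_def by (auto intro: le_supI1)
  ultimately show ?thesis unfolding sup_on_def by (auto intro!: antisym)
qed

text \<open>The dual distributive law. Replacing \<open>p\<close> by \<open>q = sup p m\<close>
  keeps the joins with \<open>a\<close> and \<open>b\<close> and moves everything into the single
  filter \<open>{m..}\<close>, where the usual derivation from the other law applies.\<close>

lemma inf_on_sup_translate:
  fixes a b p :: "'a::distributive_nearlattice"
  assumes m: "inf_on UNIV a b m"
  shows "inf_on UNIV (sup p a) (sup p b) (sup p m)"
proof -
  define q where "q = sup p m"
  have ma: "m \<le> a" and mb: "m \<le> b" using m unfolding inf_on_def by auto
  have mq: "m \<le> q" unfolding q_def by simp
  have qa: "sup q a = sup p a" and qb: "sup q b = sup p b"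
    using ma mb unfolding q_def by (simp_all add: sup.assoc sup_absorb2)
  define x where "x = sup q a"
  have mx: "m \<le> x" unfolding x_def using mq by (simp add: le_supI1)
  obtain k where k: "inf_on UNIV x (sup q b) k"
    using inf_on_UNIV_exists[of m x "sup q b"] mx mq by (auto simp: le_supI1)
  obtain l where l: "inf_on UNIV x b l" using inf_on_UNIV_exists[OF mx mb] by auto
  have xq: "inf_on UNIV x q q" unfolding inf_on_def x_def by simp
  have k_eq: "k = sup q l" by (rule inf_on_sup_distrib[OF mx mq mb k xq l])
  obtain n where n: "inf_on UNIV b q n" using inf_on_UNIV_exists[OF mb mq] by auto
  have "inf_on UNIV b (sup q a) l" "inf_on UNIV b a m"
    using l m unfolding inf_on_def x_def by auto
  \<comment> \<open>Distributing once more splits \<open>l\<close> into the meets of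
    \<open>b\<close> with \<open>q\<close> and with \<open>a\<close>, both below
    \<open>q\<close>.\<close>
  then have "l = sup n m" using inf_on_sup_distrib[OF mb mq ma _ n] by blast
  then have "l \<le> q" using n mq unfolding inf_on_def by simp
  then have "k = q" using k_eq by (simp add: sup_absorb1)
  then show ?thesis using k qa qb unfolding x_def q_def by simp
qed

section \<open>Ideals maximal among those disjoint from a filter\<close>

lemma nl_ideal_generated:
  fixes P :: "'a::distributive_nearlattice set"
  assumes "nl_ideal P"
  shows "nl_ideal {x. \<exists>p\<in>P. x \<le> sup p a}"
  unfolding nl_ideal_def
proof (intro conjI ballI allI impI)
  fix x y assume "x \<in> {x. \<exists>p\<in>P. x \<le> sup p a}" "y \<le> x"
  then show "y \<in> {x. \<exists>p\<in>P. x \<le> sup p a}" by (auto intro: order_trans)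
next
  fix x y assume "x \<in> {x. \<exists>p\<in>P. x \<le> sup p a}" "y \<in> {x. \<exists>p\<in>P. x \<le> sup p a}"
  then obtain p q where pq: "p \<in> P" "q \<in> P" "x \<le> sup p a" "y \<le> sup q a" by auto
  have "sup x y \<le> sup (sup p a) (sup q a)" using pq(3,4) by (rule sup_mono)
  also have "\<dots> = sup (sup p q) a" by (simp add: ac_simps)
  finally show "sup x y \<in> {x. \<exists>p\<in>P. x \<le> sup p a}"
    using assms pq unfolding nl_ideal_def by blast
qed

text \<open>Zorn's lemma gives \<open>M\<close>. For \<open>a\<close> outside \<open>M\<close>, the
  ideal generated by \<open>M\<close> and \<open>a\<close> must meet \<open>F\<close>, and upward
  closure of \<open>F\<close> moves the common element up to some \<open>sup p a\<close>.\<close>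

lemma maximal_ideal_disjoint_from_filter:
  fixes I F :: "'a::distributive_nearlattice set"
  assumes I: "nl_ideal I" "I \<noteq> {}" "I \<inter> F = {}" and F: "nl_filter F"
  obtains M where "nl_ideal M" "I \<subseteq> M" "M \<inter> F = {}" "\<And>a. a \<notin> M \<Longrightarrow> \<exists>p\<in>M. sup p a \<in> F"
proof -
  define S where "S = {J. nl_ideal J \<and> I \<subseteq> J \<and> J \<inter> F = {}}"
  have "\<exists>M\<in>S. \<forall>X\<in>S. M \<subseteq> X \<longrightarrow> X = M"
  proof (rule subset_Zorn_nonempty)
    show "S \<noteq> {}" using I unfolding S_def by auto
  next
    fix C assume C: "C \<noteq> {}" "subset.chain S C"
    have CS: "J \<in> S" if "J \<in> C" for J using C(2) that unfolding subset.chain_def by blast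
    have "sup x y \<in> \<Union>C" if xy: "x \<in> \<Union>C" "y \<in> \<Union>C" for x y
    proof -
      obtain J where J: "J \<in> C" "{x, y} \<subseteq> J"
        using finite_subset_Union_chain[OF _ _ C, of "{x, y}"] xy by auto
      then show ?thesis using CS[OF J(1)] unfolding S_def nl_ideal_def by auto
    qed
    moreover have "y \<in> \<Union>C" if "x \<in> \<Union>C" "y \<le> x" for x y
      using that CS unfolding S_def nl_ideal_def by blast
    ultimately have "nl_ideal (\<Union>C)" unfolding nl_ideal_def by blast
    then show "\<Union>C \<in> S" using C(1) CS unfolding S_def by blast
  qed
  then obtain M where M: "M \<in> S" and max: "\<And>X. X \<in> S \<Longrightarrow> M \<subseteq> X \<Longrightarrow> X = M" by blast
  have Mid: "nl_ideal M" "I \<subseteq> M" "M \<inter> F = {}" using M unfolding S_def by auto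
  have "\<exists>p\<in>M. sup p a \<in> F" if a: "a \<notin> M" for a
  proof -
    let ?J = "{x. \<exists>p\<in>M. x \<le> sup p a}"
    have "M \<subseteq> ?J" by (auto intro: sup_ge1)
    moreover have "a \<in> ?J" using Mid(2) I(2) by auto
    ultimately have "?J \<notin> S" using max a by blast
    then have "?J \<inter> F \<noteq> {}"
      using nl_ideal_generated[OF Mid(1)] \<open>M \<subseteq> ?J\<close> Mid(2) unfolding S_def by blast
    then show ?thesis using F unfolding nl_filter_def by blast
  qed
  with Mid that show thesis by blast
qed

lemma nl_prime_ideal_if_maximal_disjoint:
  fixes M F :: "'a::distributive_nearlattice set"
  assumes M: "nl_ideal M" "M \<noteq> {}" "M \<inter> F = {}"
    and max: "\<And>a. a \<notin> M \<Longrightarrow> \<exists>p\<in>M. sup p a \<in> F" and F: "nl_filter F"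
  shows "nl_prime_ideal M"
proof -
  have "a \<in> M \<or> b \<in> M" if m: "inf_on UNIV a b m" "m \<in> M" for a b m
  proof (rule ccontr)
    assume "\<not> ?thesis"
    then obtain p q where pq: "p \<in> M" "q \<in> M" "sup p a \<in> F" "sup q b \<in> F" using max by blast
    \<comment> \<open>A common \<open>r\<close> for both joins, so that \<open>sup r m\<close> is
      the meet of two members of \<open>F\<close>.\<close>
    define r where "r = sup p q"
    have "r \<in> M" using pq M(1) unfolding r_def nl_ideal_def by blast
    have "sup p a \<le> sup r a" "sup q b \<le> sup r b" unfolding r_def by (auto simp: le_supI1)
    then have "sup r a \<in> F" "sup r b \<in> F" using pq F unfolding nl_filter_def by blast+
    then have "sup r m \<in> F"
      using inf_on_sup_translate[OF m(1), of r] F unfolding nl_filter_def by blast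
    moreover have "sup r m \<in> M" using \<open>r \<in> M\<close> m(2) M(1) unfolding nl_ideal_def by blast
    ultimately show False using M(3) by blast
  qed
  moreover have "M \<noteq> UNIV" using M(3) F unfolding nl_filter_def by blast
  ultimately show ?thesis using M unfolding nl_prime_ideal_def by blast
qed

section \<open>Prime \<alpha>-ideals above a given ideal\<close>

lemma nl_filter_top: "nl_filter {top :: 'a::distributive_nearlattice}"
  unfolding nl_filter_def inf_on_def by (auto simp: top_le)

lemma nl_prime_ideal_top_notin: "nl_prime_ideal P \<Longrightarrow> top \<notin> P"
  unfolding nl_prime_ideal_def nl_ideal_def by (metis UNIV_eq_I top_greatest)

lemma proper_ideal_subset_prime_alpha_ideal:
  fixes I :: "'a::distributive_nearlattice set"
  assumes I: "nl_ideal I" "I \<noteq> {}" "top \<notin> I"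
  shows "\<exists>Q. nl_prime_ideal Q \<and> alpha_ideal Q \<and> I \<subseteq> Q"
proof -
  obtain M where M: "nl_ideal M" "I \<subseteq> M" "M \<inter> {top} = {}"
    and max: "\<And>a. a \<notin> M \<Longrightarrow> \<exists>p\<in>M. sup p a \<in> {top}"
    using maximal_ideal_disjoint_from_filter[OF I(1,2) _ nl_filter_top] I(3) by blast
  have "nl_prime_ideal M"
    using nl_prime_ideal_if_maximal_disjoint[OF M(1) _ M(3) max nl_filter_top] M(2) I(2) by blast
  moreover have "a \<in> M" if y: "y \<in> M" "y \<in> double_annihilator a" for a y
  proof (rule ccontr)
    assume "a \<notin> M"
    then obtain p where p: "p \<in> M" "sup p a = top" using max by blast
    \<comment> \<open>\<open>p\<close> belongs to \<open>annihilator a\<close>, so \<open>y\<close>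
      joins with it to \<open>top\<close>.\<close>
    then have "sup y p = top" using y(2) unfolding double_annihilator_def annihilator_def by blast
    moreover have "sup y p \<in> M" using y(1) p(1) M(1) unfolding nl_ideal_def by blast
    ultimately show False using M(3) by simp
  qed
  ultimately show ?thesis using M unfolding alpha_ideal_def by blast
qed

text \<open>Disjointness from \<open>annihilator a\<close> says exactly that the ideal generated by
  \<open>P\<close> and \<open>a\<close> omits \<open>top\<close>.\<close>

lemma prime_alpha_ideal_containing:
  fixes P :: "'a::distributive_nearlattice set"
  assumes P: "nl_ideal P" "P \<noteq> {}" "P \<inter> annihilator a = {}"
  shows "\<exists>Q. nl_prime_ideal Q \<and> alpha_ideal Q \<and> P \<subseteq> Q \<and> a \<in> Q"
proof -
  let ?J = "{x. \<exists>p\<in>P. x \<le> sup p a}"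
  have "top \<notin> ?J" using P(3) unfolding annihilator_def by (auto simp: top_le)
  moreover have sub: "P \<subseteq> ?J" "a \<in> ?J" using P(2) by (auto intro: sup_ge1)
  ultimately have "\<exists>Q. nl_prime_ideal Q \<and> alpha_ideal Q \<and> ?J \<subseteq> Q"
    using P(2) by (intro proper_ideal_subset_prime_alpha_ideal nl_ideal_generated P(1)) auto
  then show ?thesis using sub by blast
qed

section \<open>The Stone property and uniqueness\<close>

lemma nl_filter_Compl_prime_ideal: "nl_prime_ideal P \<Longrightarrow> nl_filter (- P)"
  using nl_prime_ideal_top_notin[of P]
  unfolding nl_filter_def nl_prime_ideal_def nl_ideal_def by blast

text \<open>Applied in both orders, this inclusion gives uniqueness.\<close>

lemma stone_prime_alpha_ideal_subset:
  fixes P Q R :: "'a::distributive_nearlattice set"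
  assumes stone: "stone TYPE('a)" and P: "nl_prime_ideal P"
    and Q: "nl_prime_ideal Q" "P \<subseteq> Q" and R: "alpha_ideal R" "P \<subseteq> R"
  shows "Q \<subseteq> R"
proof
  fix a assume a: "a \<in> Q"
  have "filter_join (annihilator a) (double_annihilator a) = UNIV"
    using stone unfolding stone_def by blast
  moreover have "- P \<noteq> UNIV" using P unfolding nl_prime_ideal_def by blast
  ultimately have "\<not> annihilator a \<union> double_annihilator a \<subseteq> - P"
    using filter_join_smallest(3)[OF nl_filter_Compl_prime_ideal[OF P]] by blast
  then consider x where "x \<in> P" "x \<in> annihilator a" | y where "y \<in> P" "y \<in> double_annihilator a"
    by blast
  then show "a \<in> R"
  proof cases
    case 1
    then have "sup x a \<in> Q" using a Q unfolding nl_prime_ideal_def nl_ideal_def by blast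
    then show ?thesis
      using 1(2) nl_prime_ideal_top_notin[OF Q(1)] unfolding annihilator_def by simp
  next
    case 2
    then show ?thesis using R unfolding alpha_ideal_def by blast
  qed
qed

lemma mem_double_annihilator: "a \<in> double_annihilator a"
  unfolding double_annihilator_def annihilator_def by (simp add: sup_commute)

lemma stone_if_unique_prime_alpha_ideal:
  assumes qc: "quasicomplemented TYPE('a::distributive_nearlattice)"
    and unique: "\<And>P Q R :: 'a set. \<lbrakk>nl_prime_ideal P; nl_prime_ideal Q; alpha_ideal Q; P \<subseteq> Q;
      nl_prime_ideal R; alpha_ideal R; P \<subseteq> R\<rbrakk> \<Longrightarrow> Q = R"
  shows "stone TYPE('a)"
proof (rule ccontr)
  assume "\<not> stone TYPE('a)"
  then obtain a p :: 'a where p: "p \<notin> filter_join (annihilator a) (double_annihilator a)"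
    unfolding stone_def by blast
  let ?F = "filter_join (annihilator a) (double_annihilator a)"
  have F: "nl_filter ?F" by (rule filter_join_smallest(1))
  have "nl_ideal {..p}" unfolding nl_ideal_def by (auto intro: order_trans)
  moreover have "{..p} \<noteq> {}" by auto
  moreover have "{..p} \<inter> ?F = {}" using p F unfolding nl_filter_def by blast
  ultimately obtain P where P: "nl_ideal P" "{..p} \<subseteq> P" "P \<inter> ?F = {}"
    and max: "\<And>a. a \<notin> P \<Longrightarrow> \<exists>p\<in>P. sup p a \<in> ?F"
    using F by (rule maximal_ideal_disjoint_from_filter) (rule that, simp_all)
  have ne: "P \<noteq> {}" using P(2) by auto
  have prime: "nl_prime_ideal P"
    by (rule nl_prime_ideal_if_maximal_disjoint[OF P(1) ne P(3) max F])
  \<comment> \<open>Quasicomplementation turns \<open>double_annihilator a\<close> into the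
    annihilator of an element, so that \<open>a\<close> and \<open>b\<close> can be treated
    alike.\<close>
  obtain b where b: "double_annihilator a = annihilator b"
    using qc unfolding quasicomplemented_def by blast
  have disj: "P \<inter> annihilator a = {}" "P \<inter> annihilator b = {}"
    using filter_join_smallest(2)[of "annihilator a" "double_annihilator a"] P(3)
    unfolding b by blast+
  obtain Q where Q: "nl_prime_ideal Q" "alpha_ideal Q" "P \<subseteq> Q" "a \<in> Q"
    using prime_alpha_ideal_containing[OF P(1) ne disj(1)] by blast
  obtain R where R: "nl_prime_ideal R" "alpha_ideal R" "P \<subseteq> R" "b \<in> R"
    using prime_alpha_ideal_containing[OF P(1) ne disj(2)] by blast
  have "Q = R" by (rule unique[OF prime Q(1-3) R(1-3)])
  then have "sup a b \<in> Q" using Q(1,4) R(4) unfolding nl_prime_ideal_def nl_ideal_def by blast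
  \<comment> \<open>\<open>a\<close> lies in its own double annihilator, which is
    \<open>annihilator b\<close>.\<close>
  moreover have "sup a b = top"
    using mem_double_annihilator[of a] unfolding b annihilator_def by simp
  ultimately show False using nl_prime_ideal_top_notin[OF Q(1)] by simp
qed

theorem theorem4p10:
  assumes "quasicomplemented TYPE('a::distributive_nearlattice)"
  shows "stone TYPE('a) \<longleftrightarrow>
    (\<forall>P :: 'a set. nl_prime_ideal P \<longrightarrow>
       (\<exists>!Q. nl_prime_ideal Q \<and> alpha_ideal Q \<and> P \<subseteq> Q))"
proof
  assume stone: "stone TYPE('a)"
  show "\<forall>P :: 'a set. nl_prime_ideal P \<longrightarrow>
       (\<exists>!Q. nl_prime_ideal Q \<and> alpha_ideal Q \<and> P \<subseteq> Q)"
  proof (intro allI impI ex_ex1I)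
    fix P :: "'a set" assume P: "nl_prime_ideal P"
    then have "nl_ideal P" "P \<noteq> {}" unfolding nl_prime_ideal_def by auto
    then show "\<exists>Q. nl_prime_ideal Q \<and> alpha_ideal Q \<and> P \<subseteq> Q"
      using nl_prime_ideal_top_notin[OF P] by (rule proper_ideal_subset_prime_alpha_ideal)
    fix Q R
    assume "nl_prime_ideal Q \<and> alpha_ideal Q \<and> P \<subseteq> Q" "nl_prime_ideal R \<and> alpha_ideal R \<and> P \<subseteq> R"
    then show "Q = R" using stone_prime_alpha_ideal_subset[OF stone P] by blast
  qed
next
  assume unique: "\<forall>P :: 'a set. nl_prime_ideal P \<longrightarrow>
       (\<exists>!Q. nl_prime_ideal Q \<and> alpha_ideal Q \<and> P \<subseteq> Q)"
  show "stone TYPE('a)"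
    by (rule stone_if_unique_prime_alpha_ideal[OF assms]) (use unique in blast)
qed

end
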